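(* Let $A \in \mathbb{R}^{m\times n}$, $B\in \mathbb{R}^{l\times n}$, and assume $B$ is injective. Then, for any $p\in[1,\infty)$, $$\|A\|_{p\mapsto1;B} \leq \min_{Y\in\mathbb{R}^{l\times m},\ B^\top Y = A^\top} \|Y\|_{L_{1,p^*}^\top} \leq \frac{\gamma_p\sqrt{m}}{\gamma_1}\|A\|_{p\mapsto1;B},$$ where $\gamma_s = \left(\frac{2^{s/2}}{\sqrt{\pi}}\Gamma\left(\frac{s+1}{2}\right)\right)^{1/s}$ for $s\in[1,\infty)$, with $\Gamma$ the Euler Gamma function.
   Context: $\|A\|_{p\mapsto 1;B} := \max_{x\in\mathbb{R}^n,\ \|Bx\|_p\leq 1} \|Ax\|_1$, where $\|\cdot\|_p$ is the vector $p$-norm. A matrix is injective if the linear map it represents is injective. $p^*$ is the Hölder conjugate of $p$ ($\frac1p+\frac1{p^*}=1$, $1^*=\infty$). For a matrix $M$ with columns $a_1,\dots,a_k$ and $r,s\in[1,\infty]$, $\|M\|_{L_{r,s}} := \big\|(\|a_1\|_r,\dots,\|a_k\|_r)^\top\big\|_s$ and $\|M\|_{L_{r,s}^\top} := \|M^\top\|_{L_{r,s}}$; thus $\|Y\|_{L_{1,p^*}^\top}$ is the $p^*$-norm of the vector of $1$-norms of the rows of $Y$. *)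

theory Defs
  imports "HOL-Analysis.Analysis"
begin

text \<open>The vector \<open>p\<close>-norm for \<open>p \<in> [1, \<infinity>]\<close>; exponents live in \<^typ>\<open>ennreal\<close> so that
  \<open>p = \<infinity>\<close> (the maximum norm) is included.\<close>

definition pnorm :: "ennreal \<Rightarrow> real ^ 'k::finite \<Rightarrow> real" where
  "pnorm p x =
     (if p = \<infinity> then Max (range (\<lambda>i. \<bar>x $ i\<bar>))
      else (\<Sum>i\<in>UNIV. \<bar>x $ i\<bar> powr enn2real p) powr (1 / enn2real p))"

definition holder_conj :: "ennreal \<Rightarrow> ennreal" where
  "holder_conj p = (THE q. 1 / p + 1 / q = 1)"

text \<open>\<open>GREATEST\<close> and \<open>LEAST\<close> denote an attained maximum and minimum; they are unspecified
  when the extremum is not attained.\<close>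

definition norm_p1B :: "real \<Rightarrow> real ^ 'n::finite ^ 'l::finite \<Rightarrow> real ^ 'n ^ 'm::finite \<Rightarrow> real" where
  "norm_p1B p B A = (GREATEST v. \<exists>x. pnorm (ennreal p) (B *v x) \<le> 1 \<and> v = pnorm 1 (A *v x))"

definition L_norm :: "ennreal \<Rightarrow> ennreal \<Rightarrow> real ^ 'k::finite ^ 'd::finite \<Rightarrow> real" where
  "L_norm r s M = pnorm s (\<chi> j. pnorm r (column j M))"

definition LT_norm :: "ennreal \<Rightarrow> ennreal \<Rightarrow> real ^ 'k::finite ^ 'd::finite \<Rightarrow> real" where
  "LT_norm r s M = L_norm r s (transpose M)"

definition gamma_const :: "real \<Rightarrow> real" where
  "gamma_const s = (2 powr (s / 2) / sqrt pi * Gamma ((s + 1) / 2)) powr (1 / s)"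

text \<open>The conjugate exponent is well defined on \<open>[1, \<infinity>]\<close>, and \<open>1\<close> and \<open>\<infinity>\<close> are conjugate.\<close>

lemma holder_conj_unique:
  fixes p :: ennreal
  assumes "1 \<le> p"
  shows "\<exists>!q. 1 / p + 1 / q = 1"
proof -
  have "0 < p"
    using assms by (metis less_le_trans zero_less_one)
  then have le: "1 / p \<le> 1"
    using assms by (intro divide_le_posI_ennreal) simp_all
  have "1 / p + 1 / q = 1 \<longleftrightarrow> q = 1 / (1 - 1 / p)" for q
  proof
    assume "1 / p + 1 / q = 1"
    then have "1 / q = 1 - 1 / p"
      using le by (metis ennreal_add_diff_cancel_left ennreal_one_less_top linorder_not_less infinity_ennreal_def)
    then show "q = 1 / (1 - 1 / p)"
      by (metis one_divide_one_divide_ennreal)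
  next
    assume "q = 1 / (1 - 1 / p)"
    then show "1 / p + 1 / q = 1"
      using le by (simp add: add_diff_self_ennreal)
  qed
  then show ?thesis by simp
qed

lemma holder_conj_eq:
  assumes "1 \<le> p"
  shows "1 / p + 1 / holder_conj p = 1"
  unfolding holder_conj_def by (rule theI'[OF holder_conj_unique[OF assms]])

lemma holder_conj_one: "holder_conj 1 = \<infinity>"
  unfolding holder_conj_def
  by (rule the1_equality[OF holder_conj_unique]) (simp_all add: divide_ennreal_def)

end

theory Submission
  imports Defs "HOL-Probability.Probability"
begin

text \<open>
  Minimizing a norm over the affine space of solutions \<open>Y\<close> of \<open>B\<^sup>T Y = A\<^sup>T\<close> is dual to maximizing a
  linear functional. In the pairing \<open>Y \<bullet> Z = \<Sum>\<^sub>i\<^sub>j Y\<^sub>i\<^sub>j Z\<^sub>i\<^sub>j\<close>, the norm ``row-wise \<open>1\<close>-norms, then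
  \<open>p*\<close>-norm'' is dual to \<open>N Z\<close>, ``row-wise maximum norms, then \<open>p\<close>-norm'', because Hoelder's inequality
  and its equality case hold on each row and again on the vector of row norms
  (\<open>LT_norm_holder\<close>, \<open>LT_norm_holder_equality\<close>). For feasible \<open>Y\<close> one has
  \<open>Y \<bullet> (B X) = trace (A X)\<close>, and separating \<open>A\<^sup>T\<close> from the image of a norm ball shows that a feasible
  \<open>Y\<close> of norm at most \<open>c\<close> exists exactly when \<open>trace (A X) \<le> c N(B X)\<close> for all \<open>X\<close>
  (\<open>c \<ge> 0\<close>). The least such \<open>c\<close> is attained, which gives a minimizer (\<open>LT_norm_minimizer_exists\<close>).

  Both inequalities of the theorem are now statements about \<open>trace (A X)\<close>. For the lower bound on the
  minimum, test with the rank-one matrix \<open>X = x y\<^sup>T\<close> where \<open>y\<close> is the sign vector of \<open>A x\<close>: then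
  \<open>trace (A X) = \<parallel>A x\<parallel>\<^sub>1\<close> and \<open>N(B X) \<le> \<parallel>B x\<parallel>\<^sub>p\<close> (\<open>pnorm_one_le_LT_norm\<close>).

  For the upper bound, write \<open>V\<close> for the maximum of \<open>\<parallel>A x\<parallel>\<^sub>1\<close> subject to \<open>\<parallel>B x\<parallel>\<^sub>p \<le> 1\<close> and substitute
  \<open>x = X g\<close> for a standard Gaussian vector \<open>g\<close> in \<open>\<parallel>A x\<parallel>\<^sub>1 \<le> V \<parallel>B x\<parallel>\<^sub>p\<close>. A linear form in \<open>g\<close> with
  coefficient vector \<open>c\<close> is a centred normal variable of standard deviation \<open>\<parallel>c\<parallel>\<^sub>2\<close>, and the constant
  \<open>\<gamma>\<^sub>s\<close> is the \<open>L\<^sub>s\<close>-norm of a standard normal variable. So the expectation of the left-hand side is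
  \<open>\<gamma>\<^sub>1\<close> times the sum of the Euclidean row norms of \<open>A X\<close>, at least \<open>\<gamma>\<^sub>1 trace (A X)\<close>; the
  \<open>L\<^sub>p\<close>-norm of \<open>\<parallel>B X g\<parallel>\<^sub>p\<close> is \<open>\<gamma>\<^sub>p\<close> times the \<open>p\<close>-norm of the Euclidean row norms of \<open>B X\<close>, and these
  are at most \<open>\<surd>m\<close> times the maximum norms of the rows (\<open>trace_le_of_pnorm_bound\<close>).
\<close>

section \<open>Duality of the vector norms\<close>

text \<open>
  The solutions of \<open>1 / p + 1 / q = 1\<close> with \<open>p\<close> and \<open>q\<close> in \<open>[1, \<infinity>]\<close>, listed by the three shapes that the
  proofs about the norms treat separately. The relation is symmetric, so that each duality statement
  can be used for a norm and for its dual.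
\<close>

definition holder_pair :: "ennreal \<Rightarrow> ennreal \<Rightarrow> bool" where
  "holder_pair p q \<longleftrightarrow> p = 1 \<and> q = top \<or> p = top \<and> q = 1 \<or>
     (\<exists>a b. 1 < a \<and> 1 < b \<and> 1 / a + 1 / b = 1 \<and> p = ennreal a \<and> q = ennreal b)"

lemma holder_pair_sym: "holder_pair p q \<Longrightarrow> holder_pair q p"
  unfolding holder_pair_def by (metis add.commute)

lemma holder_pair_nonzero: "holder_pair p q \<Longrightarrow> p \<noteq> 0"
  unfolding holder_pair_def by (auto simp: ennreal_eq_0_iff)

lemma holder_pair_one_infinity: "holder_pair 1 top"
  by (simp add: holder_pair_def)

lemma holder_pair_holder_conj:
  assumes "1 \<le> p"
  shows "holder_pair (ennreal p) (holder_conj (ennreal p))"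
proof (cases "p = 1")
  case True
  then show ?thesis by (simp add: holder_pair_def holder_conj_one)
next
  case False
  define q where "q = p / (p - 1)"
  have p: "1 < p" and q: "1 < q" and pq: "1 / p + 1 / q = 1"
    using assms False by (auto simp: q_def field_simps)
  have "1 / ennreal p + 1 / ennreal q = ennreal (1 / p + 1 / q)"
    using p q by (simp add: divide_ennreal flip: ennreal_1 ennreal_plus)
  then have "holder_conj (ennreal p) = ennreal q"
    unfolding holder_conj_def using assms pq
    by (intro the1_equality[OF holder_conj_unique]) (auto simp: ennreal_ge_1)
  then show ?thesis
    using p q pq by (auto simp: holder_pair_def)
qed

lemma pnorm_ennreal:
  assumes "0 \<le> p"
  shows "pnorm (ennreal p) x = (\<Sum>i\<in>UNIV. \<bar>x $ i\<bar> powr p) powr (1 / p)"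
  using assms by (simp add: pnorm_def)

lemma pnorm_one: "pnorm 1 x = (\<Sum>i\<in>UNIV. \<bar>x $ i\<bar>)"
  by (simp add: pnorm_def sum_nonneg)

lemma pnorm_infinity: "pnorm top x = Max (range (\<lambda>i. \<bar>x $ i\<bar>))"
  by (simp add: pnorm_def)

lemma pnorm_infinity_le_iff: "pnorm top x \<le> c \<longleftrightarrow> (\<forall>i. \<bar>x $ i\<bar> \<le> c)"
  by (subst pnorm_infinity, subst Max_le_iff) auto

lemma pnorm_nonneg: "0 \<le> pnorm p x"
proof (cases "p = top")
  case True
  have "0 \<le> \<bar>x $ i\<bar>" for i by simp
  also have "\<bar>x $ i\<bar> \<le> pnorm top x" for i
    using pnorm_infinity_le_iff by blast
  finally show ?thesis using True by simp
qed (simp add: pnorm_def)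

lemma pnorm_mono:
  assumes "\<And>i. \<bar>x $ i\<bar> \<le> \<bar>y $ i\<bar>"
  shows "pnorm p x \<le> pnorm p y"
proof (cases "p = top")
  case True
  have "\<bar>x $ i\<bar> \<le> pnorm top y" for i
    using assms[of i] pnorm_infinity_le_iff[of y "pnorm top y"] by (meson order.trans order.refl)
  then show ?thesis
    using True by (simp add: pnorm_infinity_le_iff)
next
  case False
  then show ?thesis
    using assms by (auto simp: pnorm_def intro!: powr_mono2 sum_mono sum_nonneg)
qed

lemma abs_nth_le_pnorm:
  assumes "p \<noteq> 0"
  shows "\<bar>x $ i\<bar> \<le> pnorm p x"
proof (cases "p = top")
  case True
  then show ?thesis
    using pnorm_infinity_le_iff by blast
next
  case False
  define a where "a = enn2real p"
  have a: "0 < a"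
    using assms False unfolding a_def enn2real_positive_iff
    by (metis less_top zero_less_iff_neq_zero)
  have "\<bar>x $ i\<bar> = (\<bar>x $ i\<bar> powr a) powr (1 / a)"
    using a by (simp add: powr_powr)
  also have "\<dots> \<le> (\<Sum>i\<in>UNIV. \<bar>x $ i\<bar> powr a) powr (1 / a)"
    using a by (intro powr_mono2 member_le_sum) auto
  finally show ?thesis
    using False by (simp add: pnorm_def a_def)
qed

lemma pnorm_eq_0_imp:
  assumes "p \<noteq> 0" "pnorm p x = 0"
  shows "x = 0"
  using abs_nth_le_pnorm[OF assms(1), of x] assms(2) by (simp add: vec_eq_iff)

lemma pnorm_scaleR:
  assumes "p \<noteq> 0"
  shows "pnorm p (c *\<^sub>R x) = \<bar>c\<bar> * pnorm p x"
proof (cases "p = top")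
  case True
  have "Max ((*) \<bar>c\<bar> ` range (\<lambda>i. \<bar>x $ i\<bar>)) = \<bar>c\<bar> * Max (range (\<lambda>i. \<bar>x $ i\<bar>))"
    by (intro mono_Max_commute[symmetric] monoI mult_left_mono) auto
  then show ?thesis
    using True by (simp add: pnorm_infinity image_image abs_mult)
next
  case False
  define a where "a = enn2real p"
  have a: "0 < a"
    using assms False unfolding a_def enn2real_positive_iff
    by (metis less_top zero_less_iff_neq_zero)
  have "pnorm p (c *\<^sub>R x) = (\<bar>c\<bar> powr a * (\<Sum>i\<in>UNIV. \<bar>x $ i\<bar> powr a)) powr (1 / a)"
    using False by (simp add: pnorm_def abs_mult powr_mult sum_distrib_left flip: a_def)
  also have "\<dots> = \<bar>c\<bar> * pnorm p x"
    using False a by (simp add: pnorm_def powr_mult powr_powr sum_nonneg flip: a_def)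
  finally show ?thesis .
qed

lemma pnorm_powr:
  assumes "0 < p"
  shows "pnorm (ennreal p) x powr p = (\<Sum>i\<in>UNIV. \<bar>x $ i\<bar> powr p)"
  using assms by (simp add: pnorm_ennreal powr_powr sum_nonneg)

text \<open>
  After both norms are scaled to \<open>1\<close>, Young's inequality bounds every product \<open>x\<^sub>i y\<^sub>i\<close>, and the bounds
  add up to \<open>1 / a + 1 / b = 1\<close>.
\<close>

lemma holder_ineq_finite:
  fixes x y :: "real ^ 'k::finite"
  assumes "1 < a" "1 < b" "1 / a + 1 / b = 1"
  shows "x \<bullet> y \<le> pnorm (ennreal a) x * pnorm (ennreal b) y"
proof (cases "x = 0 \<or> y = 0")
  case True
  then show ?thesis by (auto simp: pnorm_nonneg)
next
  case False
  define P Q where "P = pnorm (ennreal a) x" and "Q = pnorm (ennreal b) y"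
  have PQ: "0 < P" "0 < Q"
    using False assms pnorm_eq_0_imp[of "ennreal a" x] pnorm_eq_0_imp[of "ennreal b" y]
      pnorm_nonneg[of "ennreal a" x] pnorm_nonneg[of "ennreal b" y]
    by (auto simp: P_def Q_def less_le ennreal_eq_0_iff)
  have "x \<bullet> y / (P * Q) = (\<Sum>i\<in>UNIV. (x $ i / P) * (y $ i / Q))"
    by (simp add: inner_vec_def sum_divide_distrib)
  also have "\<dots> \<le> (\<Sum>i\<in>UNIV. \<bar>x $ i\<bar> powr a / P powr a / a + \<bar>y $ i\<bar> powr b / Q powr b / b)"
  proof (rule sum_mono)
    fix i
    have "(x $ i / P) * (y $ i / Q) \<le> (\<bar>x $ i\<bar> / P) * (\<bar>y $ i\<bar> / Q)"
      using PQ by (simp add: abs_mult[symmetric] divide_right_mono)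
    also have "\<dots> \<le> (\<bar>x $ i\<bar> / P) powr a / a + (\<bar>y $ i\<bar> / Q) powr b / b"
      using assms PQ by (intro Youngs_inequality) auto
    finally show "(x $ i / P) * (y $ i / Q) \<le>
        \<bar>x $ i\<bar> powr a / P powr a / a + \<bar>y $ i\<bar> powr b / Q powr b / b"
      using PQ by (simp add: powr_divide)
  qed
  also have "\<dots> = P powr a / P powr a / a + Q powr b / Q powr b / b"
    using assms by (simp add: sum.distrib P_def Q_def pnorm_powr flip: sum_divide_distrib)
  also have "\<dots> = 1"
    using PQ assms by simp
  finally show ?thesis
    using PQ by (simp add: P_def Q_def field_simps)
qed

lemma holder_ineq_one_infinity: "x \<bullet> y \<le> pnorm 1 x * pnorm top y"
proof -
  have "x \<bullet> y \<le> (\<Sum>i\<in>UNIV. \<bar>x $ i\<bar> * pnorm top y)"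
    unfolding inner_vec_def
  proof (rule sum_mono)
    fix i
    have "x $ i \<bullet> y $ i \<le> \<bar>x $ i\<bar> * \<bar>y $ i\<bar>"
      by (simp flip: abs_mult)
    also have "\<dots> \<le> \<bar>x $ i\<bar> * pnorm top y"
      by (intro mult_left_mono abs_nth_le_pnorm) auto
    finally show "x $ i \<bullet> y $ i \<le> \<bar>x $ i\<bar> * pnorm top y" .
  qed
  then show ?thesis by (simp add: pnorm_one sum_distrib_right)
qed

lemma holder_ineq:
  assumes "holder_pair p q"
  shows "x \<bullet> y \<le> pnorm p x * pnorm q y"
  using assms unfolding holder_pair_def
proof (elim disjE exE conjE)
  assume "p = top" "q = 1"
  then show ?thesis
    using holder_ineq_one_infinity[of y x] by (simp add: inner_commute mult.commute)
qed (auto intro: holder_ineq_one_infinity holder_ineq_finite)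

text \<open>
  Extremal vectors: the sign vector for \<open>p = 1\<close>, a signed unit vector at a coordinate of largest
  modulus for \<open>p = \<infinity>\<close>, and \<open>sgn x\<^sub>i (\<bar>x\<^sub>i\<bar> / \<parallel>x\<parallel>\<^sub>p)\<^sup>p\<^sup>-\<^sup>1\<close> in between.
\<close>

lemma holder_equality:
  fixes x :: "real ^ 'k::finite"
  assumes "holder_pair p q"
  shows "\<exists>y. pnorm q y \<le> 1 \<and> x \<bullet> y = pnorm p x"
  using assms unfolding holder_pair_def
proof (elim disjE exE conjE)
  assume "p = 1" "q = top"
  moreover have "pnorm top (\<chi> i. sgn (x $ i)) \<le> 1"
    by (subst pnorm_infinity_le_iff) (simp add: abs_sgn_eq)
  moreover have "x \<bullet> (\<chi> i. sgn (x $ i)) = pnorm 1 x"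
    by (simp add: inner_vec_def pnorm_one flip: abs_sgn)
  ultimately show ?thesis by blast
next
  assume pq: "p = top" "q = 1"
  have "Max (range (\<lambda>i. \<bar>x $ i\<bar>)) \<in> range (\<lambda>i. \<bar>x $ i\<bar>)"
    by (intro Max_in) auto
  then obtain k where k: "pnorm top x = \<bar>x $ k\<bar>"
    unfolding pnorm_infinity by (metis (no_types, lifting) imageE)
  have "pnorm 1 (axis k (sgn (x $ k))) \<le> 1"
    by (simp add: pnorm_one axis_def abs_sgn_eq if_distrib[of abs] sum.delta cong: if_cong)
  moreover have "x \<bullet> axis k (sgn (x $ k)) = pnorm top x"
    by (simp add: inner_axis k flip: abs_sgn)
  ultimately show ?thesis using pq by blast
next
  fix a b :: real
  assume ab: "1 < a" "1 < b" "1 / a + 1 / b = 1" and pq: "p = ennreal a" "q = ennreal b"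
  show ?thesis
  proof (cases "x = 0")
    case True
    then have "pnorm q 0 \<le> 1 \<and> x \<bullet> (0 :: real ^ 'k) = pnorm p x"
      using ab pq by (simp add: pnorm_ennreal)
    then show ?thesis by blast
  next
    case False
    define P where "P = pnorm p x"
    have P: "0 < P"
      using False ab pq pnorm_eq_0_imp[of p x] pnorm_nonneg[of p x]
      by (auto simp: P_def less_le ennreal_eq_0_iff)
    have Pa: "(\<Sum>i\<in>UNIV. \<bar>x $ i\<bar> powr a) = P powr a"
      using ab by (simp add: P_def pq pnorm_powr)
    have exps: "(a - 1) * b = a"
      using ab by (simp add: field_simps)
    define y :: "real ^ 'k" where "y = (\<chi> i. sgn (x $ i) * (\<bar>x $ i\<bar> / P) powr (a - 1))"
    have "\<bar>y $ i\<bar> powr b = \<bar>x $ i\<bar> powr a / P powr a" for i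
      using P exps by (cases "x $ i = 0") (auto simp: y_def abs_mult abs_sgn_eq powr_powr powr_divide)
    then have "pnorm q y = 1"
      using P ab by (simp add: pq pnorm_ennreal Pa flip: sum_divide_distrib)
    moreover have "x \<bullet> y = P"
    proof -
      have "x $ i * y $ i = \<bar>x $ i\<bar> powr a / P powr (a - 1)" for i
      proof (cases "x $ i = 0")
        case False
        have "x $ i * y $ i = \<bar>x $ i\<bar> * \<bar>x $ i\<bar> powr (a - 1) / P powr (a - 1)"
          using P by (simp add: y_def powr_divide abs_sgn mult.assoc)
        then show ?thesis
          using False by (simp add: powr_diff)
      qed simp
      then have "x \<bullet> y = P powr a / P powr (a - 1)"
        by (simp add: inner_vec_def Pa flip: sum_divide_distrib)
      then show ?thesis
        using P by (simp add: powr_diff)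
    qed
    ultimately show ?thesis
      by (intro exI[of _ y]) (simp add: P_def)
  qed
qed

section \<open>Duality of the mixed row norms\<close>

text \<open>
  The columns of \<open>Y\<^sup>T\<close> are the rows of \<open>Y\<close>, which removes the transposition from the definition: every
  later argument works first inside a row and then on the vector of row norms.
\<close>

lemma LT_norm_rows: "LT_norm r s Y = pnorm s (\<chi> i. pnorm r (Y $ i))"
proof -
  have "column i (transpose Y) = Y $ i" for i
    by (simp add: vec_eq_iff column_def transpose_def)
  then show ?thesis by (simp add: LT_norm_def L_norm_def)
qed

lemma LT_norm_nonneg: "0 \<le> LT_norm r s Y"
  by (simp add: LT_norm_rows pnorm_nonneg)

lemma LT_norm_scaleR:
  assumes "r \<noteq> 0" "s \<noteq> 0"
  shows "LT_norm r s (c *\<^sub>R Y) = \<bar>c\<bar> * LT_norm r s Y"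
proof -
  have "(\<chi> i. pnorm r ((c *\<^sub>R Y) $ i)) = \<bar>c\<bar> *\<^sub>R (\<chi> i. pnorm r (Y $ i))"
    using assms by (simp add: vec_eq_iff pnorm_scaleR)
  then show ?thesis
    using assms by (simp add: LT_norm_rows pnorm_scaleR)
qed

lemma LT_norm_holder:
  assumes "holder_pair r r'" "holder_pair s s'"
  shows "Y \<bullet> Z \<le> LT_norm r s Y * LT_norm r' s' Z"
proof -
  have "Y \<bullet> Z \<le> (\<Sum>i\<in>UNIV. pnorm r (Y $ i) * pnorm r' (Z $ i))"
    unfolding inner_vec_def[of Y Z] by (intro sum_mono holder_ineq assms)
  also have "\<dots> = (\<chi> i. pnorm r (Y $ i)) \<bullet> (\<chi> i. pnorm r' (Z $ i))"
    by (simp add: inner_vec_def)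
  also have "\<dots> \<le> LT_norm r s Y * LT_norm r' s' Z"
    unfolding LT_norm_rows by (intro holder_ineq assms)
  finally show ?thesis .
qed

text \<open>
  Take an extremal vector for each row and weight it by the entry of an extremal vector for the
  vector of row norms.
\<close>

lemma LT_norm_holder_equality:
  fixes Y :: "real ^ 'k::finite ^ 'd::finite"
  assumes "holder_pair r r'" "holder_pair s s'"
  shows "\<exists>Z. LT_norm r' s' Z \<le> 1 \<and> Y \<bullet> Z = LT_norm r s Y"
proof -
  define u where "u = (\<chi> i. pnorm r (Y $ i))"
  obtain w where w: "pnorm s' w \<le> 1" "u \<bullet> w = pnorm s u"
    using holder_equality[OF assms(2)] by blast
  have "\<forall>i. \<exists>z. pnorm r' z \<le> 1 \<and> Y $ i \<bullet> z = pnorm r (Y $ i)"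
    using holder_equality[OF assms(1)] by blast
  then obtain z where z: "\<And>i. pnorm r' (z i) \<le> 1" "\<And>i. Y $ i \<bullet> z i = pnorm r (Y $ i)"
    by metis
  define Z where "Z = (\<chi> i. w $ i *\<^sub>R z i)"
  have "pnorm r' (Z $ i) \<le> \<bar>w $ i\<bar>" for i
    using holder_pair_nonzero[OF holder_pair_sym[OF assms(1)]] z(1)[of i]
    by (simp add: Z_def pnorm_scaleR mult_left_le)
  then have "LT_norm r' s' Z \<le> pnorm s' w"
    unfolding LT_norm_rows by (intro pnorm_mono) (simp add: pnorm_nonneg)
  moreover have "Y \<bullet> Z = LT_norm r s Y"
  proof -
    have "Y \<bullet> Z = (\<Sum>i\<in>UNIV. Y $ i \<bullet> (w $ i *\<^sub>R z i))"
      unfolding inner_vec_def[of Y Z] by (simp add: Z_def)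
    also have "\<dots> = u \<bullet> w"
      unfolding inner_vec_def[of u w] by (simp add: z(2) u_def mult.commute)
    finally show ?thesis
      unfolding LT_norm_rows u_def[symmetric] w(2) .
  qed
  ultimately show ?thesis
    using w(1) by (intro exI[of _ Z]) auto
qed

lemma LT_norm_le_iff:
  assumes "holder_pair r r'" "holder_pair s s'" "0 \<le> c"
  shows "LT_norm r s Y \<le> c \<longleftrightarrow> (\<forall>Z. Y \<bullet> Z \<le> c * LT_norm r' s' Z)"
proof
  assume "LT_norm r s Y \<le> c"
  then show "\<forall>Z. Y \<bullet> Z \<le> c * LT_norm r' s' Z"
    using LT_norm_holder[OF assms(1,2), of Y] LT_norm_nonneg mult_right_mono order.trans by meson
next
  assume *: "\<forall>Z. Y \<bullet> Z \<le> c * LT_norm r' s' Z"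
  obtain Z where "LT_norm r' s' Z \<le> 1" "Y \<bullet> Z = LT_norm r s Y"
    using LT_norm_holder_equality[OF assms(1,2)] by blast
  then show "LT_norm r s Y \<le> c"
    using * assms(3) by (metis mult_left_le order.trans)
qed

text \<open>
  By duality the ball is an intersection of closed half-spaces, hence closed and convex. It is
  bounded because the norm dominates the modulus of every entry.
\<close>

lemma LT_norm_ball_compact_convex:
  fixes c :: real
  assumes "holder_pair r r'" "holder_pair s s'" "0 \<le> c"
  defines "S \<equiv> {Y :: real ^ 'k::finite ^ 'd::finite. LT_norm r s Y \<le> c}"
  shows "compact S" "convex S"
proof -
  have S: "S = (\<Inter>Z. {Y. Z \<bullet> Y \<le> c * LT_norm r' s' Z})"
    unfolding S_def LT_norm_le_iff[OF assms(1-3)] by (auto simp: inner_commute)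
  show "convex S"
    unfolding S by (intro convex_INT convex_halfspace_le)
  have "closed S"
    unfolding S by (intro closed_INT ballI closed_halfspace_le)
  moreover have "bounded S"
    unfolding bounded_iff
  proof (intro exI ballI)
    fix Y assume "Y \<in> S"
    have "\<bar>Y $ i $ j\<bar> \<le> c" for i j
    proof -
      have "\<bar>Y $ i $ j\<bar> \<le> pnorm r (Y $ i)"
        using assms(1) by (intro abs_nth_le_pnorm holder_pair_nonzero)
      also have "\<dots> \<le> LT_norm r s Y"
        using abs_nth_le_pnorm[OF holder_pair_nonzero[OF assms(2)], of "\<chi> i. pnorm r (Y $ i)" i]
        by (simp add: LT_norm_rows)
      finally show ?thesis
        using \<open>Y \<in> S\<close> by (simp add: S_def)
    qed
    then have "(\<Sum>i\<in>UNIV. \<Sum>j\<in>UNIV. \<bar>Y $ i $ j\<bar>) \<le> (\<Sum>i\<in>(UNIV::'d set). \<Sum>j\<in>(UNIV::'k set). c)"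
      by (intro sum_mono)
    moreover have "norm Y \<le> (\<Sum>i\<in>UNIV. \<Sum>j\<in>UNIV. \<bar>Y $ i $ j\<bar>)"
    proof -
      have "norm Y \<le> (\<Sum>i\<in>UNIV. norm (Y $ i))"
        unfolding norm_vec_def[of Y] by (rule L2_set_le_sum) simp
      also have "\<dots> \<le> (\<Sum>i\<in>UNIV. \<Sum>j\<in>UNIV. \<bar>Y $ i $ j\<bar>)"
        by (intro sum_mono norm_le_l1_cart)
      finally show ?thesis .
    qed
    ultimately show "norm Y \<le> (\<Sum>i\<in>(UNIV::'d set). \<Sum>j\<in>(UNIV::'k set). c)"
      by linarith
  qed
  ultimately show "compact S"
    by (simp add: compact_eq_bounded_closed)
qed

section \<open>Minimal-norm solutions of a linear matrix equation\<close>

lemma inner_transpose_matrix_mult: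
  fixes B :: "real ^ 'n::finite ^ 'l::finite" and Y :: "real ^ 'm::finite ^ 'l" and X :: "real ^ 'm ^ 'n"
  shows "(transpose B ** Y) \<bullet> X = Y \<bullet> (B ** X)"
proof -
  have "(transpose B ** Y) \<bullet> X = (\<Sum>k\<in>UNIV. \<Sum>j\<in>UNIV. \<Sum>i\<in>UNIV. B $ i $ k * Y $ i $ j * X $ k $ j)"
    by (simp add: inner_vec_def matrix_matrix_mult_def transpose_def sum_distrib_right)
  also have "\<dots> = (\<Sum>k\<in>UNIV. \<Sum>i\<in>UNIV. \<Sum>j\<in>UNIV. B $ i $ k * Y $ i $ j * X $ k $ j)"
    by (intro sum.cong refl sum.swap)
  also have "\<dots> = (\<Sum>i\<in>UNIV. \<Sum>k\<in>UNIV. \<Sum>j\<in>UNIV. B $ i $ k * Y $ i $ j * X $ k $ j)"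
    by (rule sum.swap)
  also have "\<dots> = (\<Sum>i\<in>UNIV. \<Sum>j\<in>UNIV. \<Sum>k\<in>UNIV. B $ i $ k * Y $ i $ j * X $ k $ j)"
    by (intro sum.cong refl sum.swap)
  also have "\<dots> = Y \<bullet> (B ** X)"
    by (simp add: inner_vec_def matrix_matrix_mult_def sum_distrib_left mult_ac)
  finally show ?thesis .
qed

lemma inner_transpose_eq_trace:
  fixes A :: "real ^ 'n::finite ^ 'm::finite" and X :: "real ^ 'm ^ 'n"
  shows "transpose A \<bullet> X = trace (A ** X)"
  by (simp add: inner_vec_def trace_def matrix_matrix_mult_def transpose_def) (rule sum.swap)

text \<open>
  Otherwise a hyperplane with normal \<open>W\<close> separates \<open>A\<^sup>T\<close> from the image of the ball of radius \<open>c\<close> under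
  \<open>Y \<mapsto> B\<^sup>T Y\<close>. The functional \<open>Y \<mapsto> (B\<^sup>T Y) \<bullet> (-W) = Y \<bullet> (B (-W))\<close> reaches \<open>c\<close> times the dual norm of
  \<open>B (-W)\<close> on that ball, so \<open>X = -W\<close> violates the bound on the trace.
\<close>

lemma exists_LT_norm_bounded_solution:
  fixes A :: "real ^ 'n::finite ^ 'm::finite" and B :: "real ^ 'n ^ 'l::finite"
  assumes "holder_pair r r'" "holder_pair s s'" "0 \<le> c"
    and bound: "\<And>X :: real ^ 'm ^ 'n. trace (A ** X) \<le> c * LT_norm r' s' (B ** X)"
  shows "\<exists>Y. transpose B ** Y = transpose A \<and> LT_norm r s Y \<le> c"
proof (rule ccontr)
  assume none: "\<not> ?thesis"
  define S where "S = {Y :: real ^ 'm ^ 'l. LT_norm r s Y \<le> c}"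
  have lin: "linear (\<lambda>Y :: real ^ 'm ^ 'l. transpose B ** Y)"
    by (intro linearI) (simp_all add: matrix_add_ldistrib matrix_scalar_ac
        scalar_matrix_assoc scalar_mult_eq_scaleR[symmetric] flip: scalar_mult_eq_scaleR)
  define T where "T = (\<lambda>Y. transpose B ** Y) ` S"
  have "compact T" "convex T"
    unfolding T_def S_def
    using LT_norm_ball_compact_convex[OF assms(1-3)] lin
    by (auto intro!: compact_continuous_image convex_linear_image linear_continuous_on
        simp: linear_conv_bounded_linear)
  moreover have "transpose A \<notin> T"
    using none by (auto simp: T_def S_def)
  ultimately obtain W b where W: "W \<bullet> transpose A < b" "\<And>V. V \<in> T \<Longrightarrow> b < W \<bullet> V"
    using separating_hyperplane_closed_point compact_imp_closed by metis
  obtain Z where Z: "LT_norm r s Z \<le> 1" "(B ** (- W)) \<bullet> Z = LT_norm r' s' (B ** (- W))"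
    using LT_norm_holder_equality[OF assms(1,2)[THEN holder_pair_sym], of "B ** (- W)"] by blast
  have "c *\<^sub>R Z \<in> S"
    using Z(1) assms holder_pair_nonzero
    by (simp add: S_def LT_norm_scaleR mult_left_le)
  then have "b < W \<bullet> (transpose B ** (c *\<^sub>R Z))"
    by (intro W(2)) (simp add: T_def)
  also have "\<dots> = - (c * LT_norm r' s' (B ** (- W)))"
    using inner_transpose_matrix_mult[of B "c *\<^sub>R Z" "- W"] Z(2)
    by (simp add: inner_commute)
  also have "\<dots> \<le> - trace (A ** (- W))"
    using bound[of "- W"] by simp
  also have "\<dots> = W \<bullet> transpose A"
    by (simp add: inner_transpose_eq_trace[symmetric] inner_commute)
  finally show False
    using W(1) by simp
qed

text \<open>
  Weak duality: a feasible \<open>Y\<close> turns the trace into the pairing of \<open>Y\<close> with \<open>B X\<close>.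
\<close>

lemma trace_le_LT_norm:
  fixes A :: "real ^ 'n::finite ^ 'm::finite" and B :: "real ^ 'n ^ 'l::finite"
  assumes "holder_pair r r'" "holder_pair s s'" "transpose B ** Y = transpose A"
  shows "trace (A ** X) \<le> LT_norm r s Y * LT_norm r' s' (B ** X)"
  using LT_norm_holder[OF assms(1,2), of Y "B ** X"]
  by (simp add: inner_transpose_eq_trace[symmetric] inner_transpose_matrix_mult flip: assms(3))

text \<open>
  Strong duality. The constants admissible in the trace bound form a closed set, so there is a least
  one. It is the norm of some solution, while weak duality makes the norm of any solution admissible;
  hence that solution is minimal.
\<close>

theorem LT_norm_minimizer_exists:
  fixes A :: "real ^ 'n::finite ^ 'm::finite" and B :: "real ^ 'n ^ 'l::finite"
  assumes pairs: "holder_pair r r'" "holder_pair s s'" and "0 \<le> K"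
    and bound: "\<And>X :: real ^ 'm ^ 'n. trace (A ** X) \<le> K * LT_norm r' s' (B ** X)"
  shows "\<exists>Y. is_arg_min (LT_norm r s) (\<lambda>Y. transpose B ** Y = transpose A) Y \<and> LT_norm r s Y \<le> K"
proof -
  define D where "D = {c. 0 \<le> c \<and> (\<forall>X :: real ^ 'm ^ 'n. trace (A ** X) \<le> c * LT_norm r' s' (B ** X))}"
  define c where "c = Inf D"
  have D: "D \<noteq> {}" "bdd_below D" "K \<in> D"
    using assms by (auto simp: D_def intro: bdd_belowI)
  have "c \<in> D"
  proof -
    have "closed D"
    proof -
      have "D = {0..} \<inter> (\<Inter>X. {c. trace (A ** X) \<le> c * LT_norm r' s' (B ** X)})"
        by (auto simp: D_def)
      then show ?thesis
        by (auto intro!: closed_Int closed_INT closed_Collect_le continuous_intros)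
    qed
    then show ?thesis
      unfolding c_def using D by (intro closed_contains_Inf)
  qed
  then obtain Y where Y: "transpose B ** Y = transpose A" "LT_norm r s Y \<le> c"
    using exists_LT_norm_bounded_solution[OF pairs, of c A B] by (auto simp: D_def)
  have "c \<le> LT_norm r s Y'" if "transpose B ** Y' = transpose A" for Y'
    unfolding c_def using D(2) trace_le_LT_norm[OF pairs that] LT_norm_nonneg
    by (intro cInf_lower) (auto simp: D_def)
  moreover have "c \<le> K"
    unfolding c_def using D by (intro cInf_lower)
  ultimately show ?thesis
    using Y by (intro exI[of _ Y]) (force simp: is_arg_min_linorder)
qed

section \<open>Absolute moments of Gaussian linear forms\<close>

text \<open>
  Substitute \<open>t = x\<^sup>2 / 2\<close> in the integral that represents the Gamma function.
\<close>

lemma gaussian_half_line_integral: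
  fixes p :: real
  assumes "0 < p"
  shows "((\<lambda>x. x powr p * exp (- x\<^sup>2 / 2)) has_integral
           2 powr ((p - 1) / 2) * Gamma ((p + 1) / 2)) {0..}"
proof -
  define f where "f = (\<lambda>t::real. t powr ((p + 1) / 2 - 1) / exp t)"
  have "((\<lambda>t. f t) has_integral Gamma ((p + 1) / 2)) {0..}"
    unfolding f_def using assms by (intro Gamma_integral_real) simp
  moreover have nonneg: "0 \<le> f t" for t
    by (simp add: f_def)
  ultimately have f: "f absolutely_integrable_on {0..}" "integral {0..} f = Gamma ((p + 1) / 2)"
    by (auto simp: absolutely_integrable_on_iff_nonneg has_integral_iff)
  have img: "(\<lambda>x::real. x\<^sup>2 / 2) ` {0..} = {0..}"
  proof (intro equalityI subsetI)
    fix y :: real assume "y \<in> {0..}"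
    then show "y \<in> (\<lambda>x. x\<^sup>2 / 2) ` {0..}"
      by (intro image_eqI[of _ _ "sqrt (2 * y)"]) auto
  qed auto
  have "((\<lambda>x. \<bar>x\<bar> * f (x\<^sup>2 / 2)) absolutely_integrable_on {0..} \<and>
           integral {0..} (\<lambda>x. \<bar>x\<bar> * f (x\<^sup>2 / 2)) = Gamma ((p + 1) / 2))
     \<longleftrightarrow> f absolutely_integrable_on ((\<lambda>x. x\<^sup>2 / 2) ` {0..}) \<and>
           integral ((\<lambda>x. x\<^sup>2 / 2) ` {0..}) f = Gamma ((p + 1) / 2)"
    by (rule has_absolute_integral_change_of_variables_1')
       (auto intro!: derivative_eq_intros inj_onI)
  then have "((\<lambda>x. \<bar>x\<bar> * f (x\<^sup>2 / 2)) has_integral Gamma ((p + 1) / 2)) {0..}"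
    using f unfolding img by (auto simp: has_integral_iff absolutely_integrable_on_def)
  then have "((\<lambda>x. 2 powr ((p - 1) / 2) * (\<bar>x\<bar> * f (x\<^sup>2 / 2))) has_integral
      2 powr ((p - 1) / 2) * Gamma ((p + 1) / 2)) {0..}"
    by (rule has_integral_mult_right)
  moreover have "2 powr ((p - 1) / 2) * (\<bar>x\<bar> * f (x\<^sup>2 / 2)) = x powr p * exp (- x\<^sup>2 / 2)"
    if "x \<in> {0..}" for x :: real
  proof (cases "x = 0")
    case False
    then have x: "x > 0" using that by simp
    have "(x\<^sup>2 / 2) powr ((p - 1) / 2) = x powr (p - 1) / 2 powr ((p - 1) / 2)"
      using x by (simp add: powr_divide powr_powr diff_divide_distrib flip: powr_numeral)
    moreover have "x * x powr (p - 1) = x powr p"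
      using x by (simp add: powr_diff)
    moreover have "(p + 1) / 2 - 1 = (p - 1) / 2"
      by (simp add: field_simps)
    ultimately show ?thesis
      using x by (simp add: f_def exp_minus field_simps)
  qed simp
  ultimately show ?thesis
    by (rule has_integral_eq[rotated])
qed

lemma gamma_const_powr:
  assumes "0 < p"
  shows "gamma_const p powr p = 2 powr (p / 2) / sqrt pi * Gamma ((p + 1) / 2)"
  using assms Gamma_real_pos[of "(p + 1) / 2"] by (simp add: gamma_const_def powr_powr)

lemma gamma_const_pos:
  assumes "0 < p"
  shows "0 < gamma_const p"
proof -
  have "Gamma ((p + 1) / 2) > 0"
    using assms by (intro Gamma_real_pos) simp
  then show ?thesis by (simp add: gamma_const_def)
qed

text \<open>
  This identifies \<open>\<gamma>\<^sub>p\<close> as the \<open>L\<^sub>p\<close>-norm of a standard normal variable.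
\<close>

lemma std_normal_abs_moment:
  assumes "0 < p"
  shows "has_bochner_integral lborel (\<lambda>x. std_normal_density x * \<bar>x\<bar> powr p) (gamma_const p powr p)"
proof -
  define I where "I = 2 powr ((p - 1) / 2) * Gamma ((p + 1) / 2)"
  have "0 \<le> I"
    unfolding I_def using assms Gamma_real_pos[of "(p + 1) / 2"] by simp
  have "(\<integral>\<^sup>+x. ennreal (indicator {0..} x * (x powr p * exp (- x\<^sup>2 / 2))) \<partial>lborel) = ennreal I"
    using gaussian_half_line_integral[OF assms] unfolding I_def
    by (intro nn_integral_has_integral_lebesgue) auto
  also have "(\<lambda>x. ennreal (indicator {0..} x * (x powr p * exp (- x\<^sup>2 / 2)))) =
      (\<lambda>x. ennreal (indicator {0..} x *\<^sub>R (\<bar>x\<bar> powr p * exp (- x\<^sup>2 / 2))))"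
    by (auto simp: indicator_def)
  finally have "has_bochner_integral lborel
      (\<lambda>x. indicator {0..} x *\<^sub>R (\<bar>x\<bar> powr p * exp (- x\<^sup>2 / 2))) I"
    using \<open>0 \<le> I\<close> by (intro has_bochner_integral_nn_integral) (auto simp: indicator_def)
  then have "has_bochner_integral lborel (\<lambda>x. \<bar>x\<bar> powr p * exp (- x\<^sup>2 / 2)) (2 *\<^sub>R I)"
    by (rule has_bochner_integral_even_function) simp
  then have "has_bochner_integral lborel (\<lambda>x. 1 / sqrt (2 * pi) * (\<bar>x\<bar> powr p * exp (- x\<^sup>2 / 2)))
      (1 / sqrt (2 * pi) * (2 *\<^sub>R I))"
    by (intro has_bochner_integral_mult_right)
  moreover have "1 / sqrt (2 * pi) * (2 *\<^sub>R I) = gamma_const p powr p"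
  proof -
    have "2 * 2 powr ((p - 1) / 2) = sqrt 2 * (2::real) powr (p / 2)"
      by (simp add: diff_divide_distrib powr_diff powr_half_sqrt real_div_sqrt flip: times_divide_eq_left)
    then show ?thesis
      unfolding gamma_const_powr[OF assms] I_def by (simp add: real_sqrt_mult field_simps)
  qed
  ultimately show ?thesis
    by (simp add: std_normal_density_def mult_ac)
qed

definition std_gaussian :: "('k::finite \<Rightarrow> real) measure" where
  "std_gaussian = (\<Pi>\<^sub>M j\<in>UNIV. density lborel std_normal_density)"

lemma prob_space_std_gaussian: "prob_space (std_gaussian :: ('k::finite \<Rightarrow> real) measure)"
  unfolding std_gaussian_def by (intro prob_space_PiM prob_space_normal_density) simp

lemma measurable_std_gaussian_coord [measurable]:
  "(\<lambda>g. g j) \<in> borel_measurable (std_gaussian :: ('k::finite \<Rightarrow> real) measure)"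
  unfolding std_gaussian_def by (rule measurable_PiM_component_rev) auto

lemma distr_std_gaussian_coord:
  "distr (std_gaussian :: ('k::finite \<Rightarrow> real) measure) lborel (\<lambda>g. g j) = density lborel std_normal_density"
proof -
  have "distr (std_gaussian :: ('k \<Rightarrow> real) measure) (density lborel std_normal_density) (\<lambda>g. g j)
      = density lborel std_normal_density"
    unfolding std_gaussian_def
    by (rule distr_PiM_component) (auto simp: prob_space_normal_density)
  then show ?thesis
    by (metis distr_cong sets_density)
qed

lemma distributed_std_gaussian_coord:
  "distributed (std_gaussian :: ('k::finite \<Rightarrow> real) measure) lborel (\<lambda>g. g j) std_normal_density"
  using distr_std_gaussian_coord measurable_std_gaussian_coord by (auto simp: distributed_def)

lemma indep_std_gaussian_coords:
  "prob_space.indep_vars (std_gaussian :: ('k::finite \<Rightarrow> real) measure)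
     (\<lambda>_. borel) (\<lambda>j g. g j) UNIV"
proof -
  interpret prob_space "std_gaussian :: ('k \<Rightarrow> real) measure"
    by (rule prob_space_std_gaussian)
  have "distr std_gaussian borel (\<lambda>g. g j) = density lborel std_normal_density" for j :: 'k
    using distr_std_gaussian_coord[of j] by (metis distr_cong sets_lborel)
  moreover have "distr std_gaussian (\<Pi>\<^sub>M j\<in>UNIV. borel) (\<lambda>g::'k \<Rightarrow> real. \<lambda>j\<in>UNIV. g j) = std_gaussian"
  proof -
    have "distr std_gaussian (\<Pi>\<^sub>M j\<in>UNIV. borel) (\<lambda>g::'k \<Rightarrow> real. g) = distr std_gaussian std_gaussian (\<lambda>g. g)"
      by (rule distr_cong) (auto simp: std_gaussian_def intro!: sets_PiM_cong)
    then show ?thesis by (simp add: restrict_UNIV)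
  qed
  ultimately show ?thesis
    by (subst indep_vars_iff_distr_eq_PiM') (auto simp: std_gaussian_def[symmetric])
qed

text \<open>
  The linear form is a sum of independent centred normal variables with standard deviations \<open>\<bar>c\<^sub>j\<bar>\<close>,
  hence normal with standard deviation \<open>\<parallel>c\<parallel>\<^sub>2\<close>; its moments are rescaled moments of the standard normal
  distribution.
\<close>

lemma std_gaussian_linear_form_moment:
  fixes c :: "'k::finite \<Rightarrow> real"
  assumes "0 < p"
  shows "has_bochner_integral std_gaussian (\<lambda>g. \<bar>\<Sum>j\<in>UNIV. c j * g j\<bar> powr p)
           ((gamma_const p * L2_set c UNIV) powr p)"
proof (cases "c = (\<lambda>_. 0)")
  case True
  then show ?thesis
    by (simp add: L2_set_0' has_bochner_integral_zero)
next
  case False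
  interpret prob_space "std_gaussian :: ('k \<Rightarrow> real) measure"
    by (rule prob_space_std_gaussian)
  \<comment> \<open>Zero coefficients give constant summands, which have no normal density.\<close>
  define J where "J = {j. c j \<noteq> 0}"
  define \<sigma> where "\<sigma> = L2_set c UNIV"
  have "J \<noteq> {}"
    using False by (auto simp: J_def)
  have "\<sigma> > 0"
    using False L2_set_nonneg[of c UNIV] by (auto simp: \<sigma>_def L2_set_eq_0_iff less_le)
  have "distributed std_gaussian lborel (\<lambda>g. \<Sum>j\<in>J. c j * g j)
      (normal_density (\<Sum>j\<in>J. 0) (sqrt (\<Sum>j\<in>J. \<bar>c j\<bar>\<^sup>2)))"
  proof (rule sum_indep_normal)
    show "indep_vars (\<lambda>_. borel) (\<lambda>j g. c j * g j) J"
      by (rule indep_vars_compose2[OF indep_vars_subset[OF indep_std_gaussian_coords]]) auto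
    fix j assume "j \<in> J"
    then show "0 < \<bar>c j\<bar>" by (simp add: J_def)
    show "distributed std_gaussian lborel (\<lambda>g. c j * g j) (normal_density 0 \<bar>c j\<bar>)"
      using normal_density_affine[OF distributed_std_gaussian_coord, of "c j" 0] \<open>j \<in> J\<close>
      by (simp add: J_def)
  qed (use \<open>J \<noteq> {}\<close> in auto)
  moreover have "(\<Sum>j\<in>J. c j * g j) = (\<Sum>j\<in>UNIV. c j * g j)" for g
    by (intro sum.mono_neutral_left) (auto simp: J_def)
  moreover have "sqrt (\<Sum>j\<in>J. \<bar>c j\<bar>\<^sup>2) = \<sigma>"
    unfolding \<sigma>_def L2_set_def by (intro arg_cong[of _ _ sqrt] sum.mono_neutral_cong_left) (auto simp: J_def)
  ultimately have D: "distributed std_gaussian lborel (\<lambda>g. (\<Sum>j\<in>UNIV. c j * g j) / \<sigma>) std_normal_density"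
    using normal_standard_normal_convert[OF \<open>\<sigma> > 0\<close>, of "\<lambda>g. \<Sum>j\<in>UNIV. c j * g j" 0] by simp
  have "has_bochner_integral std_gaussian (\<lambda>g. \<bar>(\<Sum>j\<in>UNIV. c j * g j) / \<sigma>\<bar> powr p) (gamma_const p powr p)"
    using std_normal_abs_moment[OF assms]
      distributed_integrable[OF D, of "\<lambda>x. \<bar>x\<bar> powr p"]
      distributed_integral[OF D, of "\<lambda>x. \<bar>x\<bar> powr p"]
    by (simp add: has_bochner_integral_iff)
  then have "has_bochner_integral std_gaussian
      (\<lambda>g. \<sigma> powr p * \<bar>(\<Sum>j\<in>UNIV. c j * g j) / \<sigma>\<bar> powr p) (\<sigma> powr p * gamma_const p powr p)"
    by (intro has_bochner_integral_mult_right)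
  moreover have "\<sigma> powr p * \<bar>t / \<sigma>\<bar> powr p = \<bar>t\<bar> powr p" for t
    using \<open>\<sigma> > 0\<close> by (simp add: powr_divide)
  ultimately show ?thesis
    using \<open>\<sigma> > 0\<close> gamma_const_pos[OF assms] by (simp add: powr_mult mult.commute \<sigma>_def)
qed

section \<open>Gaussian averaging of an operator inequality\<close>

text \<open>
  The tangent-line estimate for the convex function \<open>t\<^sup>p\<close> at \<open>s\<close>, solved for \<open>t\<close>. Integrated, it bounds a first moment by \<open>s\<close> as soon as the
  \<open>p\<close>-th moment is at most \<open>s\<^sup>p\<close>, which is the form of Jensen's inequality used below.
\<close>

lemma le_powr_interpolation:
  fixes p s t :: real
  assumes "1 \<le> p" "0 < s" "0 \<le> t"
  shows "t \<le> (t powr p / s powr (p - 1) + (p - 1) * s) / p"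
proof (cases "t = 0")
  case False
  define u where "u = t powr p / s powr (p - 1)"
  have "u > 0"
    using assms False by (simp add: u_def)
  have "u powr (1 / p) * s powr (1 - 1 / p) = t"
  proof -
    have "u powr (1 / p) = t / s powr (1 - 1 / p)"
      using assms by (simp add: u_def powr_divide powr_powr diff_divide_distrib)
    then show ?thesis
      using assms by simp
  qed
  moreover have "u powr (1 / p) * s powr (1 - 1 / p) \<le> 1 / p * u + (1 - 1 / p) * s"
    using assms \<open>u > 0\<close> by (intro Youngs_inequality_0) auto
  moreover have "1 / p * u + (1 - 1 / p) * s = (u + (p - 1) * s) / p"
    using assms by (simp add: field_simps)
  ultimately show ?thesis
    by (simp add: u_def)
qed (use assms in simp)

lemma std_gaussian_pnorm_moment:
  fixes Q :: "real ^ 'k::finite ^ 'l::finite"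
  assumes "0 < p"
  shows "has_bochner_integral std_gaussian (\<lambda>g. pnorm (ennreal p) (Q *v (\<chi> j. g j)) powr p)
           (\<Sum>i\<in>UNIV. (gamma_const p * norm (Q $ i)) powr p)"
proof -
  have "norm (Q $ i) = L2_set (\<lambda>j. Q $ i $ j) UNIV" for i
    by (simp add: norm_vec_def L2_set_def)
  then show ?thesis
    using std_gaussian_linear_form_moment[OF assms]
    by (auto simp: pnorm_powr[OF assms] matrix_vector_mult_def intro!: has_bochner_integral_sum)
qed

text \<open>
  Average the hypothesis over a standard Gaussian vector \<open>x = g\<close>. Entry \<open>i\<close> of \<open>P g\<close> has mean modulus
  \<open>\<gamma>\<^sub>1\<close> times the Euclidean norm of row \<open>i\<close> of \<open>P\<close>, which dominates the diagonal entry. On the right the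
  first moment of \<open>\<parallel>Q g\<parallel>\<^sub>p\<close> is controlled by its \<open>p\<close>-th moment, and the Euclidean norm of a row with \<open>m\<close>
  entries is at most \<open>\<surd>m\<close> times its maximum norm.
\<close>

lemma trace_le_of_pnorm_bound:
  fixes P :: "real ^ 'm::finite ^ 'm" and Q :: "real ^ 'm ^ 'l::finite"
  assumes "1 \<le> p" "0 \<le> V"
    and bound: "\<And>x. pnorm 1 (P *v x) \<le> V * pnorm (ennreal p) (Q *v x)"
  shows "trace P \<le> gamma_const p * sqrt (real CARD('m)) / gamma_const 1 * V * LT_norm top (ennreal p) Q"
proof -
  interpret prob_space "std_gaussian :: ('m \<Rightarrow> real) measure"
    by (rule prob_space_std_gaussian)
  have p: "0 < p" using assms by simp
  define N where "N = LT_norm top (ennreal p) Q"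
  define T where "T = gamma_const p * (sqrt (real CARD('m)) * N)"
  define F G where "F = (\<lambda>g. pnorm (ennreal p) (Q *v (\<chi> j. g j)))"
    and "G = (\<lambda>g. pnorm 1 (P *v (\<chi> j. g j)))"
  define R where "R = (\<Sum>i\<in>UNIV. (gamma_const p * norm (Q $ i)) powr p)"
  have N: "0 \<le> N" by (simp add: N_def LT_norm_nonneg)
  have T: "0 \<le> T" using N gamma_const_pos[OF p] by (simp add: T_def)
  have F: "has_bochner_integral std_gaussian (\<lambda>g. F g powr p) R"
    unfolding F_def R_def by (rule std_gaussian_pnorm_moment[OF p])
  have G: "has_bochner_integral std_gaussian G (\<Sum>i\<in>UNIV. gamma_const 1 * norm (P $ i))"
    using std_gaussian_pnorm_moment[of 1 P] gamma_const_pos[of 1]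
    by (simp add: G_def pnorm_nonneg)
  have "R \<le> T powr p"
  proof -
    have row: "norm (Q $ i) \<le> sqrt (real CARD('m)) * pnorm top (Q $ i)" for i
    proof -
      have "norm (Q $ i) \<le> L2_set (\<lambda>_. pnorm top (Q $ i)) (UNIV :: 'm set)"
        unfolding norm_vec_def[of "Q $ i"]
        by (intro L2_set_mono) (auto intro: abs_nth_le_pnorm)
      also have "\<dots> = sqrt (real CARD('m)) * pnorm top (Q $ i)"
        by (simp add: L2_set_constant pnorm_nonneg)
      finally show ?thesis .
    qed
    have "R \<le> (\<Sum>i\<in>UNIV. (gamma_const p * (sqrt (real CARD('m)) * pnorm top (Q $ i))) powr p)"
      unfolding R_def using row p gamma_const_pos[OF p]
      by (intro sum_mono powr_mono2 mult_left_mono) auto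
    also have "\<dots> = (gamma_const p * sqrt (real CARD('m))) powr p * (\<Sum>i\<in>UNIV. pnorm top (Q $ i) powr p)"
      using gamma_const_pos[OF p]
      by (simp add: powr_mult pnorm_nonneg sum_distrib_left mult.assoc)
    also have "(\<Sum>i\<in>UNIV. pnorm top (Q $ i) powr p) = N powr p"
      by (simp add: N_def LT_norm_rows pnorm_powr[OF p] pnorm_nonneg)
    also have "(gamma_const p * sqrt (real CARD('m))) powr p * N powr p = T powr p"
      using gamma_const_pos[OF p] N by (simp add: T_def powr_mult mult.assoc)
    finally show ?thesis .
  qed
  \<comment> \<open>The comparison point \<open>s\<close> must be positive, while \<open>T\<close> vanishes for \<open>Q = 0\<close>; hence \<open>s\<close> exceeds \<open>T\<close>
    and tends to it at the end.\<close>
  have key: "gamma_const 1 * trace P \<le> V * s" if "T < s" for s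
  proof -
    have s: "0 < s" using T that by simp
    define H where "H = (\<lambda>g. V * ((F g powr p / s powr (p - 1) + (p - 1) * s) / p))"
    have H: "has_bochner_integral std_gaussian H (V * ((R / s powr (p - 1) + (p - 1) * s) / p))"
    proof -
      have "has_bochner_integral std_gaussian (\<lambda>g :: 'm \<Rightarrow> real. s) s"
        by (simp add: has_bochner_integral_iff prob_space)
      then show ?thesis
        unfolding H_def using F
        by (intro has_bochner_integral_mult_right has_bochner_integral_divide has_bochner_integral_add)
    qed
    have "gamma_const 1 * trace P \<le> (\<Sum>i\<in>UNIV. gamma_const 1 * norm (P $ i))"
      unfolding trace_def sum_distrib_left
    proof (intro sum_mono mult_left_mono)
      fix i
      show "P $ i $ i \<le> norm (P $ i)"
        using component_le_norm_cart[of "P $ i" i] by linarith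
    qed (use gamma_const_pos[of 1] in simp)
    also have "\<dots> \<le> V * ((R / s powr (p - 1) + (p - 1) * s) / p)"
      unfolding has_bochner_integral_integral_eq[OF G, symmetric]
        has_bochner_integral_integral_eq[OF H, symmetric]
    proof (rule integral_mono)
      fix g :: "'m \<Rightarrow> real"
      have "G g \<le> V * F g"
        unfolding G_def F_def by (rule bound)
      also have "\<dots> \<le> H g"
        unfolding H_def using assms s
        by (intro mult_left_mono le_powr_interpolation) (auto simp: F_def pnorm_nonneg)
      finally show "G g \<le> H g" .
    qed (use G H in \<open>auto simp: has_bochner_integral_iff\<close>)
    also have "\<dots> \<le> V * ((s powr p / s powr (p - 1) + (p - 1) * s) / p)"
    proof -
      have "R \<le> s powr p"
        using \<open>R \<le> T powr p\<close> T that p by (meson less_imp_le order.trans powr_mono2)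
      then show ?thesis
        using assms by (intro mult_left_mono divide_right_mono add_right_mono) auto
    qed
    also have "\<dots> = V * s"
      using s p by (simp add: powr_diff field_simps)
    finally show ?thesis .
  qed
  have "gamma_const 1 * trace P \<le> V * T"
  proof (rule field_le_epsilon)
    fix e :: real assume "0 < e"
    then have "T < T + e / (V + 1)"
      using assms by simp
    from key[OF this] have "gamma_const 1 * trace P \<le> V * T + V * (e / (V + 1))"
      by (simp add: distrib_left)
    also have "V * (e / (V + 1)) \<le> e"
      using assms \<open>0 < e\<close> by (simp add: field_simps)
    finally show "gamma_const 1 * trace P \<le> V * T + e" by simp
  qed
  then show ?thesis
    using gamma_const_pos[of 1] by (simp add: T_def N_def field_simps)
qed

section \<open>Bounds on the minimal norm\<close>

text \<open>
  Injectivity of \<open>B\<close> makes the preimage of the unit ball bounded, hence compact.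
\<close>

lemma pnorm_attains_max_on_preimage_ball:
  fixes A :: "real ^ 'n::finite ^ 'm::finite" and B :: "real ^ 'n ^ 'l::finite"
  assumes "inj ((*v) B)" "1 \<le> p"
  shows "\<exists>x. is_arg_max (\<lambda>x. pnorm 1 (A *v x)) (\<lambda>x. pnorm (ennreal p) (B *v x) \<le> 1) x"
proof -
  define S where "S = {x. pnorm (ennreal p) (B *v x) \<le> 1}"
  have "compact S"
  proof -
    have "closed S"
      unfolding S_def pnorm_ennreal[OF order.trans[OF zero_le_one assms(2)]]
      using assms(2)
      by (intro closed_Collect_le continuous_on_powr' continuous_intros
            linear_continuous_on_compose[OF continuous_on_id]) (auto simp: sum_nonneg)
    moreover have "bounded S"
    proof -
      obtain b where b: "b > 0" "\<And>x. b * norm x \<le> norm (B *v x)"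
        using linear_inj_bounded_below_pos[OF matrix_vector_mul_linear assms(1)] by blast
      have "norm x \<le> real CARD('l) / b" if "x \<in> S" for x
      proof -
        have "\<bar>(B *v x) $ i\<bar> \<le> 1" for i
          using abs_nth_le_pnorm[of "ennreal p" "B *v x" i] assms(2) that
          by (simp add: S_def ennreal_eq_0_iff)
        then have "(\<Sum>i\<in>UNIV. \<bar>(B *v x) $ i\<bar>) \<le> (\<Sum>i\<in>(UNIV :: 'l set). 1)"
          by (intro sum_mono)
        then have "b * norm x \<le> real CARD('l)"
          using b(2)[of x] norm_le_l1_cart[of "B *v x"] by simp
        then show ?thesis
          using b(1) by (simp add: field_simps)
      qed
      then show ?thesis
        by (auto simp: bounded_iff)
    qed
    ultimately show ?thesis
      by (simp add: compact_eq_bounded_closed)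
  qed
  moreover have "0 \<in> S"
    using assms(2) by (simp add: S_def pnorm_ennreal)
  moreover have "continuous_on S (\<lambda>x. pnorm 1 (A *v x))"
    unfolding pnorm_one
    by (intro continuous_intros linear_continuous_on_compose[OF continuous_on_id]) auto
  ultimately obtain x where "x \<in> S" "\<forall>y\<in>S. pnorm 1 (A *v y) \<le> pnorm 1 (A *v x)"
    using continuous_attains_sup[of S "\<lambda>x. pnorm 1 (A *v x)"] by blast
  then show ?thesis
    by (intro exI[of _ x]) (auto simp: is_arg_max_linorder S_def)
qed

text \<open>
  Weak duality for the rank-one matrix \<open>X = x y\<^sup>T\<close>, where \<open>y\<close> is extremal for the \<open>1\<close>-norm of \<open>A x\<close>.
\<close>

lemma pnorm_one_le_LT_norm:
  fixes A :: "real ^ 'n::finite ^ 'm::finite" and B :: "real ^ 'n ^ 'l::finite"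
  assumes "holder_pair p q" "transpose B ** Y = transpose A" "pnorm p (B *v x) \<le> 1"
  shows "pnorm 1 (A *v x) \<le> LT_norm 1 q Y"
proof -
  obtain y where y: "pnorm top y \<le> 1" "(A *v x) \<bullet> y = pnorm 1 (A *v x)"
    using holder_equality[OF holder_pair_one_infinity] by blast
  define X :: "real ^ 'm ^ 'n" where "X = (\<chi> k. x $ k *\<^sub>R y)"
  have BX: "(B ** X) $ i = (B *v x) $ i *\<^sub>R y" for i
    by (simp add: vec_eq_iff X_def matrix_matrix_mult_def matrix_vector_mult_def
        sum_distrib_right mult.assoc)
  have "pnorm 1 (A *v x) = trace (A ** X)"
    unfolding y(2)[symmetric]
    by (simp add: trace_def X_def matrix_matrix_mult_def matrix_vector_mult_def
        inner_vec_def sum_distrib_right mult.assoc)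
  also have "\<dots> \<le> LT_norm 1 q Y * LT_norm top p (B ** X)"
    by (rule trace_le_LT_norm[OF holder_pair_one_infinity holder_pair_sym[OF assms(1)] assms(2)])
  also have "\<dots> \<le> LT_norm 1 q Y"
  proof (rule mult_left_le)
    have "pnorm top ((B ** X) $ i) \<le> \<bar>(B *v x) $ i\<bar>" for i
      unfolding BX using y(1) by (simp add: pnorm_scaleR mult_left_le)
    then have "LT_norm top p (B ** X) \<le> pnorm p (B *v x)"
      unfolding LT_norm_rows by (intro pnorm_mono) (simp add: pnorm_nonneg)
    then show "LT_norm top p (B ** X) \<le> 1"
      using assms(3) by simp
  qed (rule LT_norm_nonneg)
  finally show ?thesis .
qed

theorem theorem5p9:
  fixes A :: "real ^ 'n::finite ^ 'm::finite"
    and B :: "real ^ 'n ^ 'l::finite"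
    and p :: real
  assumes "inj ((*v) B)"
    and "1 \<le> p"
  shows "(\<exists>x. is_arg_max (\<lambda>x. pnorm 1 (A *v x)) (\<lambda>x. pnorm (ennreal p) (B *v x) \<le> 1) x) \<and>
    (\<exists>Y :: real ^ 'm ^ 'l.
       is_arg_min (LT_norm 1 (holder_conj (ennreal p))) (\<lambda>Y. transpose B ** Y = transpose A) Y) \<and>
    norm_p1B p B A
      \<le> (LEAST v. \<exists>Y :: real ^ 'm ^ 'l.
            transpose B ** Y = transpose A \<and> v = LT_norm 1 (holder_conj (ennreal p)) Y) \<and>
    (LEAST v. \<exists>Y :: real ^ 'm ^ 'l.
            transpose B ** Y = transpose A \<and> v = LT_norm 1 (holder_conj (ennreal p)) Y)
      \<le> gamma_const p * sqrt (real CARD('m)) / gamma_const 1 * norm_p1B p B A"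
proof -
  define q where "q = holder_conj (ennreal p)"
  have pq: "holder_pair (ennreal p) q"
    unfolding q_def by (rule holder_pair_holder_conj[OF assms(2)])
  obtain x where x: "is_arg_max (\<lambda>x. pnorm 1 (A *v x)) (\<lambda>x. pnorm (ennreal p) (B *v x) \<le> 1) x"
    using pnorm_attains_max_on_preimage_ball[OF assms] by blast
  define V where "V = pnorm 1 (A *v x)"
  have feasible: "pnorm (ennreal p) (B *v x) \<le> 1"
    and maximal: "\<And>y. pnorm (ennreal p) (B *v y) \<le> 1 \<Longrightarrow> pnorm 1 (A *v y) \<le> V"
    using x by (auto simp: is_arg_max_linorder V_def)
  have norm_eq: "norm_p1B p B A = V"
    unfolding norm_p1B_def using feasible maximal by (intro Greatest_equality) (auto simp: V_def)
  have V: "0 \<le> V" by (simp add: V_def pnorm_nonneg)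
  \<comment> \<open>By homogeneity the maximum bounds the ratio of the two norms.\<close>
  have bound: "pnorm 1 (A *v y) \<le> V * pnorm (ennreal p) (B *v y)" for y
  proof (cases "y = 0")
    case False
    define t where "t = pnorm (ennreal p) (B *v y)"
    have "B *v y \<noteq> 0"
      using False assms(1) by (metis injD matrix_vector_mult_0_right)
    then have t: "0 < t"
      using pnorm_eq_0_imp[OF holder_pair_nonzero[OF pq]] pnorm_nonneg by (auto simp: t_def less_le)
    have "pnorm (ennreal p) (B *v ((1 / t) *\<^sub>R y)) \<le> 1"
      using t holder_pair_nonzero[OF pq]
      by (simp add: matrix_vector_mult_scaleR pnorm_scaleR flip: t_def)
    from maximal[OF this] show ?thesis
      using t by (simp add: matrix_vector_mult_scaleR pnorm_scaleR field_simps flip: t_def)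
  qed (simp add: pnorm_one V pnorm_nonneg)
  define K where "K = gamma_const p * sqrt (real CARD('m)) / gamma_const 1 * V"
  have "0 \<le> K"
    using gamma_const_pos[of p] gamma_const_pos[of 1] assms(2) V by (simp add: K_def)
  moreover have "trace (A ** X) \<le> K * LT_norm top (ennreal p) (B ** X)" for X :: "real ^ 'm ^ 'n"
    unfolding K_def using bound
    by (intro trace_le_of_pnorm_bound assms(2) V) (simp flip: matrix_vector_mul_assoc)
  ultimately obtain Y where Y: "is_arg_min (LT_norm 1 q) (\<lambda>Y. transpose B ** Y = transpose A) Y"
      "LT_norm 1 q Y \<le> K"
    using LT_norm_minimizer_exists[OF holder_pair_one_infinity holder_pair_sym[OF pq]] by blast
  have least_eq: "(LEAST v. \<exists>Y. transpose B ** Y = transpose A \<and> v = LT_norm 1 q Y) = LT_norm 1 q Y"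
    using Y(1) by (intro Least_equality) (auto simp: is_arg_min_linorder)
  have "V \<le> LT_norm 1 q Y"
    unfolding V_def using Y(1) feasible
    by (intro pnorm_one_le_LT_norm[OF pq]) (auto simp: is_arg_min_linorder)
  then show ?thesis
    using x Y unfolding q_def[symmetric] norm_eq least_eq K_def by blast
qed

end
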